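(* Let $n\ge 3$ and let $p>2$ be a prime number with $p>n-2$. Then the $F$-threshold of the ring $R_{p,n+1}$ is $c^{\mathbf m}(\mathbf m)=n$.
   Context: $R_{p,n+1}=k[x_0,\dots,x_{n+1}]/(x_0^2+\cdots+x_{n+1}^2)$, where $k$ is a perfect field of characteristic $p>2$, and $\mathbf m=(x_0,\dots,x_{n+1})$. The $F$-threshold is $c^{\mathbf m}(\mathbf m)=\lim_{s\to\infty}\max\{r\in\mathbb N: \mathbf m^r\not\subseteq\mathbf m^{[q]}\}/q$, $q=p^s$, where $\mathbf m^{[q]}$ is the ideal generated by the $q$-th powers of elements of $\mathbf m$. *)

theory Defs
  imports
    Complex_Main
    "HOL-Library.Poly_Mapping"
    "HOL-Computational_Algebra.Primes"
    "HOL-Algebra.QuotRing"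
    "HOL-Algebra.Ideal_Product"
begin

definition perfect_field :: "'k::field itself \<Rightarrow> bool"
  where "perfect_field _ \<longleftrightarrow> CHAR('k) = 0 \<or> surj (\<lambda>x::'k. x ^ CHAR('k))"

text \<open>
  A monomial is a finitely supported exponent function of type \<^typ>\<open>'v \<Rightarrow>\<^sub>0 nat\<close>, and a
  polynomial is a finitely supported map from monomials to coefficients. The type allows
  all variables indexed by \<^typ>\<open>'v\<close>; the carrier keeps those polynomials that only involve
  variables with index in \<open>V\<close>.
\<close>

type_synonym ('v, 'k) mpoly = "('v \<Rightarrow>\<^sub>0 nat) \<Rightarrow>\<^sub>0 'k"

definition mpoly_ring :: "'v set \<Rightarrow> ('v, 'k::field) mpoly ring"
  where "mpoly_ring V =
    \<lparr> carrier = {f. \<forall>m \<in> Poly_Mapping.keys f. Poly_Mapping.keys m \<subseteq> V},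
      mult = (*), one = 1, zero = 0, add = (+) \<rparr>"

definition var :: "'v \<Rightarrow> ('v, 'k::field) mpoly"
  where "var i = Poly_Mapping.single (Poly_Mapping.single i 1) 1"

lemma mpoly_ring_cring: "cring (mpoly_ring V :: ('v, 'k::field) mpoly ring)"
proof -
  let ?C = "{f :: ('v, 'k) mpoly. \<forall>m \<in> Poly_Mapping.keys f. Poly_Mapping.keys m \<subseteq> V}"
  have add: "f + g \<in> ?C" if "f \<in> ?C" "g \<in> ?C" for f g
    using that Poly_Mapping.keys_add[of f g] by blast
  have mult: "f * g \<in> ?C" if fg: "f \<in> ?C" "g \<in> ?C" for f g
  proof -
    have "Poly_Mapping.keys m \<subseteq> V" if m: "m \<in> Poly_Mapping.keys (f * g)" for m
    proof -
      obtain a b where "m = a + b" "a \<in> Poly_Mapping.keys f" "b \<in> Poly_Mapping.keys g"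
        using Poly_Mapping.keys_mult[of f g] m by blast
      then show ?thesis
        using fg Poly_Mapping.keys_add[of a b] by blast
    qed
    then show ?thesis by blast
  qed
  have minus: "- f \<in> ?C" if "f \<in> ?C" for f
    using that by (simp add: in_keys_iff)
  have one: "1 \<in> ?C"
    by simp
  have zero: "0 \<in> ?C"
    by simp
  show ?thesis
  proof (rule cringI)
    show "abelian_group (mpoly_ring V :: ('v, 'k) mpoly ring)"
    proof (rule abelian_groupI)
      fix f g :: "('v, 'k) mpoly"
      assume "f \<in> carrier (mpoly_ring V)" "g \<in> carrier (mpoly_ring V)"
      then show "f \<oplus>\<^bsub>mpoly_ring V\<^esub> g \<in> carrier (mpoly_ring V)"
        using add[of f g] by (simp add: mpoly_ring_def)
    next
      fix f :: "('v, 'k) mpoly"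
      assume "f \<in> carrier (mpoly_ring V)"
      then have "- f \<in> carrier (mpoly_ring V)"
        using minus by (auto simp: mpoly_ring_def)
      then show "\<exists>g \<in> carrier (mpoly_ring V). g \<oplus>\<^bsub>mpoly_ring V\<^esub> f = \<zero>\<^bsub>mpoly_ring V\<^esub>"
        by (intro bexI[of _ "- f"]) (simp_all add: mpoly_ring_def)
    qed (simp_all add: mpoly_ring_def ac_simps)
    show "comm_monoid (mpoly_ring V :: ('v, 'k) mpoly ring)"
    proof (rule comm_monoidI)
      fix f g :: "('v, 'k) mpoly"
      assume "f \<in> carrier (mpoly_ring V)" "g \<in> carrier (mpoly_ring V)"
      then show "f \<otimes>\<^bsub>mpoly_ring V\<^esub> g \<in> carrier (mpoly_ring V)"
        using mult[of f g] by (simp add: mpoly_ring_def)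
    qed (simp_all add: mpoly_ring_def ac_simps)
  qed (simp add: mpoly_ring_def distrib_right)
qed

lemma var_in_carrier: "var i \<in> carrier (mpoly_ring V) \<longleftrightarrow> i \<in> V"
  by (simp add: var_def mpoly_ring_def)

text \<open>The ring $k[x_0, \dots, x_N] / (x_0^2 + \dots + x_N^2)$ and its ideal $(x_0, \dots, x_N)$.\<close>

definition quadric_ideal :: "'k::field itself \<Rightarrow> nat \<Rightarrow> (nat, 'k) mpoly set"
  where "quadric_ideal _ N = genideal (mpoly_ring {..N}) {\<Sum>i\<le>N. var i ^ 2}"

definition quadric_ring :: "'k::field itself \<Rightarrow> nat \<Rightarrow> (nat, 'k) mpoly set ring"
  where "quadric_ring k N = mpoly_ring {..N} Quot quadric_ideal k N"

definition quadric_max_ideal :: "'k::field itself \<Rightarrow> nat \<Rightarrow> (nat, 'k) mpoly set set"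
  where "quadric_max_ideal k N =
    genideal (quadric_ring k N)
      ((\<lambda>i. quadric_ideal k N +>\<^bsub>mpoly_ring {..N}\<^esub> var i) ` {..N})"

definition frobenius_power :: "('a, 'b) ring_scheme \<Rightarrow> 'a set \<Rightarrow> nat \<Rightarrow> 'a set"
  where "frobenius_power R I q = genideal R ((\<lambda>a. a [^]\<^bsub>R\<^esub> q) ` I)"

text \<open>
  The ordinary powers of an ideal are its powers in the semiring \<^const>\<open>ideals_set\<close>. The set
  below is nonempty and finite when \<open>J\<close> is a proper ideal, \<open>I\<close> is finitely generated and
  contained in the radical of \<open>J\<close>, and \<open>q > 0\<close>; otherwise the value of
  \<^const>\<open>Max\<close> is meaningless.
\<close>

definition threshold_exponent :: "('a, 'b) ring_scheme \<Rightarrow> 'a set \<Rightarrow> 'a set \<Rightarrow> nat \<Rightarrow> nat"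
  where "threshold_exponent R J I q =
    Max {r. \<not> I [^]\<^bsub>ideals_set R\<^esub> r \<subseteq> frobenius_power R J q}"

text \<open>
  The \<open>F\<close>-threshold $c^J(I)$ of a ring of characteristic \<open>p\<close> exists and equals \<open>c\<close>.
\<close>

definition has_F_threshold ::
  "('a, 'b) ring_scheme \<Rightarrow> nat \<Rightarrow> 'a set \<Rightarrow> 'a set \<Rightarrow> real \<Rightarrow> bool"
  where "has_F_threshold R p J I c \<longleftrightarrow>
    (\<lambda>s. real (threshold_exponent R J I (p ^ s)) / real (p ^ s)) \<longlonglongrightarrow> c"

end

theory Submission
  imports Defs
begin

text \<open>
  Write \<open>N = n + 1\<close>, \<open>q = p ^ s\<close> and \<open>Q = x_0^2 + ... + x_N^2\<close>. The largest \<open>r\<close> with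
  \<open>m^r\<close> not contained in \<open>m^[q]\<close> is exactly \<open>n (q - 1)\<close>, and \<open>n (q - 1) / q\<close> tends to \<open>n\<close>.
  In the polynomial ring the question becomes in which degrees every form lies in
  the ideal \<open>J\<close> generated by \<open>Q\<close> and the \<open>q\<close>-th powers of the polynomials without constant term.

  In degree above \<open>n (q - 1)\<close> all forms lie in \<open>J\<close>. Over the prime field \<open>-1\<close> is a sum of two squares,
  so the four squares \<open>x_0^2 + ... + x_3^2\<close> split as \<open>u v + w z\<close> with linear forms \<open>u, v, w, z\<close> that
  span the same space as \<open>x_0, ..., x_3\<close>. Suppose first that the other variables are absent. Modulo
  \<open>u v + w z\<close> the monomial \<open>u^a v^b w^c z^d\<close> can be rewritten, by trading factors \<open>w z\<close> for \<open>u v\<close> or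
  conversely, so that an exponent \<open>max a b + min c d\<close> or an exponent \<open>max c d + min a b\<close> appears.
  These add up to the degree, so in degree at least \<open>2 q - 1\<close> one of them is at least \<open>q\<close>
  (\<open>hyperbolic_monomial_in_ideal\<close>). The remaining \<open>n - 2\<close> variables are nilpotent modulo \<open>J\<close>
  and contribute at most \<open>(n - 2) (q - 1)\<close> to the degree of a monomial outside \<open>J\<close>. In their presence
  a trade leaves an error term of higher degree in them, which is absorbed by descending induction
  (\<open>hyperbolic_tail_monomial_in_ideal\<close>, \<open>irrelevant_power_subset_ideal\<close>).

  In degree \<open>n (q - 1)\<close> the monomial \<open>f = x_2^(q-1) ... x_N^(q-1)\<close> is not in \<open>J\<close>. In characteristic
  \<open>p\<close> the \<open>q\<close>-th powers of polynomials without constant term, \<open>Q^q\<close> among them, lie in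
  \<open>(x_0^q, ..., x_N^q)\<close>, so multiplication by \<open>Q^(q-1)\<close> maps \<open>J\<close> into that ideal. But modulo it,
  \<open>Q^(q-1) f\<close> equals \<open>(x_0^2 + x_1^2)^(q-1) f\<close>, which is the middle binomial coefficient times the
  product of all \<open>x_i^(q-1)\<close>; that coefficient is prime to \<open>p\<close>
  (\<open>sum_squares_power_times_socle_notin_bracket_ideal\<close>).
\<close>

section \<open>Arithmetic modulo a prime\<close>

text \<open>
  In the prime field \<open>F\<close> of \<open>p\<close> elements the set \<open>A\<close> of squares has \<open>(p + 1) / 2\<close> elements, and so has
  its image \<open>B\<close> under the reflection \<open>t \<mapsto> -1 - t\<close>; hence they meet.
\<close>

lemma neg_one_sum_of_two_squares:
  assumes "prime CHAR('k::field)" and "CHAR('k::field) > 2"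
  obtains \<alpha> \<beta> :: "'k::field" where "\<alpha>\<^sup>2 + \<beta>\<^sup>2 = -1"
proof -
  define p where "p = CHAR('k)"
  have p: "prime p" "p > 2" "odd p"
    using assms by (auto simp: p_def prime_odd_nat)
  define H where "H = {..(p - 1) div 2}"
  define F where "F = (of_int :: int \<Rightarrow> 'k) ` {0..<int p}"
  have F: "of_int x \<in> F" for x
  proof -
    have "int p dvd x - x mod int p"
      by (simp add: dvd_minus_mod)
    then have "(of_int (x - x mod int p) :: 'k) = 0"
      by (simp only: of_int_eq_0_iff_char_dvd p_def)
    then have "(of_int x :: 'k) = of_int (x mod int p)"
      by simp
    then show ?thesis
      using p by (auto simp: F_def)
  qed
  have cardF: "finite F" "card F \<le> p"
    using card_image_le[of "{0..<int p}" "of_int :: int \<Rightarrow> 'k"] by (auto simp: F_def)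
  have inj: "inj_on (\<lambda>x. (of_nat x :: 'k)\<^sup>2) H"
  proof (rule inj_onI)
    fix x y assume xy: "x \<in> H" "y \<in> H" and "(of_nat x :: 'k)\<^sup>2 = (of_nat y)\<^sup>2"
    then have "(of_int (int x - int y) :: 'k) = 0 \<or> (of_nat (x + y) :: 'k) = 0"
      by (auto simp: power2_eq_iff)
    then have "int p dvd int x - int y \<or> p dvd x + y"
      by (simp only: of_int_eq_0_iff_char_dvd of_nat_eq_0_iff_char_dvd p_def)
    moreover have "x + y < p"
      using xy p by (auto simp: H_def)
    moreover have "\<bar>int x - int y\<bar> < int p"
      using \<open>x + y < p\<close> by linarith
    ultimately show "x = y"
      using dvd_imp_le_int[of "int x - int y" "int p"] by (auto dest!: dvd_imp_le)
  qed
  define A where "A = (\<lambda>x. (of_nat x :: 'k)\<^sup>2) ` H"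
  define B where "B = (\<lambda>t. -1 - t) ` A"
  have "A \<subseteq> F"
    using F[of "int _ ^ 2"] by (auto simp: A_def)
  moreover have "B \<subseteq> F"
    using F[of "-1 - int _ ^ 2"] by (auto simp: A_def B_def)
  moreover have "card A = (p + 1) div 2"
    using card_image[OF inj] p by (auto simp: A_def H_def elim!: oddE)
  moreover have "card B = card A"
    unfolding B_def by (rule card_image) (auto intro: inj_onI)
  ultimately have "card A + card B > card F" "A \<union> B \<subseteq> F"
    using cardF p by (auto elim!: oddE)
  then have "A \<inter> B \<noteq> {}"
    using card_mono[OF cardF(1), of "A \<union> B"] cardF finite_subset[of A F] finite_subset[of B F]
    by (auto simp: card_Un_disjoint)
  then show ?thesis
    using that by (force simp: A_def B_def algebra_simps)
qed

lemma prime_dvd_choose_prime_power: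
  fixes p :: nat
  assumes "prime p" "0 < j" "j < p ^ s"
  shows "p dvd (p ^ s choose j)"
proof (rule ccontr)
  assume "\<not> p dvd (p ^ s choose j)"
  then have "coprime (p ^ s) (p ^ s choose j)"
    using assms(1) by (simp add: prime_imp_coprime coprime_power_left_iff)
  moreover have "p ^ s dvd j * (p ^ s choose j)"
    using assms(2) by (simp add: times_binomial_minus1_eq)
  ultimately have "p ^ s dvd j"
    by (simp add: coprime_dvd_mult_left_iff)
  then show False
    using assms(2,3) by (auto dest: dvd_imp_le)
qed

text \<open>
  By Pascal's rule neighbouring entries of row \<open>p ^ s - 1\<close> add up to an inner entry of row \<open>p ^ s\<close>,
  which is \<open>0\<close> modulo \<open>p\<close>. So the entries of row \<open>p ^ s - 1\<close> are \<open>1, -1, 1, ...\<close> modulo \<open>p\<close>.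
\<close>

lemma prime_not_dvd_choose_prime_power_minus_1:
  fixes p :: nat
  assumes "prime p" "j < p ^ s"
  shows "\<not> p dvd (p ^ s - 1 choose j)"
  using assms(2)
proof (induction j)
  case 0
  then show ?case using assms(1) by (auto simp: prime_nat_iff)
next
  case (Suc j)
  have "p ^ s choose Suc j = (p ^ s - 1 choose j) + (p ^ s - 1 choose Suc j)"
    using Suc.prems binomial_Suc_Suc[of "p ^ s - 1" j]
    by (simp only: Suc_pred[of "p ^ s", simplified] Suc_diff_1 less_trans[OF zero_less_Suc])
  moreover have "p dvd (p ^ s choose Suc j)"
    using prime_dvd_choose_prime_power assms(1) Suc.prems by blast
  ultimately show ?case
    using Suc by (auto simp: dvd_add_left_iff)
qed

section \<open>Polynomial rings and powers of the ideal of the variables\<close>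

lemma sum_single_keys: "f = (\<Sum>m\<in>Poly_Mapping.keys f. Poly_Mapping.single m (Poly_Mapping.lookup f m))"
  by (rule poly_mapping_eqI)
     (simp add: lookup_sum lookup_single when_def if_distrib sum.delta in_keys_iff cong: if_cong)

lemma single_power:
  "Poly_Mapping.single m c ^ k = (Poly_Mapping.single (\<Sum>j<k. m) (c ^ k) :: ('v, 'k::field) mpoly)"
  by (induction k) (simp_all add: mult_single add.commute)

lemma var_power:
  "var i ^ k = (Poly_Mapping.single (Poly_Mapping.single i k) 1 :: ('v, 'k::field) mpoly)"
proof -
  have "(\<Sum>j<k. Poly_Mapping.single i 1) = Poly_Mapping.single i k"
    by (rule poly_mapping_eqI) (simp add: lookup_sum lookup_single when_def)
  then show ?thesis
    by (simp add: var_def single_power)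
qed

lemma CHAR_mpoly: "CHAR(('v, 'k::field) mpoly) = CHAR('k::field)"
proof (rule CHAR_eqI)
  show "of_nat CHAR('k) = (0 :: ('v, 'k) mpoly)"
    by (metis of_nat_CHAR single_of_nat single_zero)
  fix n assume "of_nat n = (0 :: ('v, 'k) mpoly)"
  then have "Poly_Mapping.lookup (of_nat n :: ('v, 'k) mpoly) 0 = 0"
    by simp
  then show "CHAR('k) dvd n"
    by (simp add: lookup_of_nat of_nat_eq_0_iff_char_dvd)
qed

text \<open>
  Calculations take place in the ambient type, whose ring operations are those of
  \<^const>\<open>mpoly_ring\<close>; the carrier enters only through closure rules.
\<close>

lemma mpoly_ring_simps:
  "mult (mpoly_ring V) = (*)" "one (mpoly_ring V) = 1" "zero (mpoly_ring V) = 0"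
  "add (mpoly_ring V) = (+)"
  by (simp_all add: mpoly_ring_def)

lemma a_minus_mpoly_ring:
  assumes "f \<in> carrier (mpoly_ring V)" "g \<in> carrier (mpoly_ring V)"
  shows "f \<ominus>\<^bsub>mpoly_ring V\<^esub> g = f - (g :: ('v, 'k::field) mpoly)"
proof -
  interpret P: cring "mpoly_ring V :: ('v, 'k) mpoly ring" by (rule mpoly_ring_cring)
  have "(f \<ominus>\<^bsub>mpoly_ring V\<^esub> g) \<oplus>\<^bsub>mpoly_ring V\<^esub> g = f"
    using assms by algebra
  then show ?thesis
    by (simp add: mpoly_ring_simps algebra_simps)
qed

lemma nat_pow_mpoly_ring: "f [^]\<^bsub>mpoly_ring V\<^esub> (k::nat) = (f :: ('v, 'k::field) mpoly) ^ k"
  by (induction k) (simp_all add: nat_pow_def mpoly_ring_simps mult.commute)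

lemma mpoly_ring_closed:
  fixes f g :: "('v, 'k::field) mpoly"
  shows "f \<in> carrier (mpoly_ring V) \<Longrightarrow> g \<in> carrier (mpoly_ring V) \<Longrightarrow> f + g \<in> carrier (mpoly_ring V)"
    and "f \<in> carrier (mpoly_ring V) \<Longrightarrow> g \<in> carrier (mpoly_ring V) \<Longrightarrow> f - g \<in> carrier (mpoly_ring V)"
    and "f \<in> carrier (mpoly_ring V) \<Longrightarrow> g \<in> carrier (mpoly_ring V) \<Longrightarrow> f * g \<in> carrier (mpoly_ring V)"
    and "f \<in> carrier (mpoly_ring V) \<Longrightarrow> f ^ k \<in> carrier (mpoly_ring V)"
    and "Poly_Mapping.keys m \<subseteq> V \<Longrightarrow> Poly_Mapping.single m c \<in> carrier (mpoly_ring V :: ('v, 'k) mpoly ring)"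
proof -
  interpret P: cring "mpoly_ring V :: ('v, 'k) mpoly ring" by (rule mpoly_ring_cring)
  show "f \<in> carrier (mpoly_ring V) \<Longrightarrow> g \<in> carrier (mpoly_ring V) \<Longrightarrow> f + g \<in> carrier (mpoly_ring V)"
    using P.a_closed[of f g] by (simp add: mpoly_ring_simps)
  show "f \<in> carrier (mpoly_ring V) \<Longrightarrow> g \<in> carrier (mpoly_ring V) \<Longrightarrow> f - g \<in> carrier (mpoly_ring V)"
    using P.minus_closed[of f g] by (simp add: a_minus_mpoly_ring)
  show "f \<in> carrier (mpoly_ring V) \<Longrightarrow> g \<in> carrier (mpoly_ring V) \<Longrightarrow> f * g \<in> carrier (mpoly_ring V)"
    using P.m_closed[of f g] by (simp add: mpoly_ring_simps)
  show "f \<in> carrier (mpoly_ring V) \<Longrightarrow> f ^ k \<in> carrier (mpoly_ring V)"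
    using P.nat_pow_closed[of f k] by (simp add: nat_pow_mpoly_ring)
  show "Poly_Mapping.keys m \<subseteq> V \<Longrightarrow> Poly_Mapping.single m c \<in> carrier (mpoly_ring V :: ('v, 'k) mpoly ring)"
    by (auto simp: mpoly_ring_def)
qed

lemma mpoly_ideal_closed:
  fixes f g :: "('v, 'k::field) mpoly"
  assumes "ideal J (mpoly_ring V)"
  shows "0 \<in> J"
    and "f \<in> J \<Longrightarrow> f \<in> carrier (mpoly_ring V)"
    and "f \<in> J \<Longrightarrow> g \<in> J \<Longrightarrow> f + g \<in> J"
    and "f \<in> J \<Longrightarrow> g \<in> J \<Longrightarrow> f - g \<in> J"
    and "f \<in> carrier (mpoly_ring V) \<Longrightarrow> g \<in> J \<Longrightarrow> f * g \<in> J"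
    and "(\<And>x. x \<in> X \<Longrightarrow> h x \<in> J) \<Longrightarrow> sum h X \<in> J"
proof -
  interpret J: ideal J "mpoly_ring V" by fact
  show zero: "0 \<in> J"
    using additive_subgroup.zero_closed[OF J.additive_subgroup_axioms] by (simp add: mpoly_ring_simps)
  show carr: "f \<in> carrier (mpoly_ring V)" if "f \<in> J" for f
    using that by (rule J.Icarr)
  show add: "f + g \<in> J" if "f \<in> J" "g \<in> J" for f g
    using additive_subgroup.a_closed[OF J.additive_subgroup_axioms that] by (simp add: mpoly_ring_simps)
  show mult: "f * g \<in> J" if "f \<in> carrier (mpoly_ring V)" "g \<in> J" for f g
    using J.I_l_closed[of g f] that by (simp add: mpoly_ring_simps)
  have "0 - 1 \<in> carrier (mpoly_ring V :: ('v, 'k) mpoly ring)"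
    by (intro mpoly_ring_closed) (auto simp: mpoly_ring_def)
  then show "f \<in> J \<Longrightarrow> g \<in> J \<Longrightarrow> f - g \<in> J"
    using add[of f "(0 - 1) * g"] mult[of "0 - 1" g] by simp
  show "sum h X \<in> J" if "\<And>x. x \<in> X \<Longrightarrow> h x \<in> J"
    using that by (induction X rule: infinite_finite_induct) (auto simp: zero intro: add)
qed

lemma mpoly_ring_idealI:
  fixes J :: "('v, 'k::field) mpoly set"
  assumes carr: "J \<subseteq> carrier (mpoly_ring V)" and zero: "0 \<in> J"
    and add: "\<And>f g. f \<in> J \<Longrightarrow> g \<in> J \<Longrightarrow> f + g \<in> J"
    and mult: "\<And>f g. f \<in> carrier (mpoly_ring V) \<Longrightarrow> g \<in> J \<Longrightarrow> f * g \<in> J"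
  shows "ideal J (mpoly_ring V)"
proof -
  interpret P: cring "mpoly_ring V :: ('v, 'k) mpoly ring" by (rule mpoly_ring_cring)
  have minus: "\<ominus>\<^bsub>mpoly_ring V\<^esub> f \<in> J" if "f \<in> J" for f
  proof -
    have "\<ominus>\<^bsub>mpoly_ring V\<^esub> f = (\<ominus>\<^bsub>mpoly_ring V\<^esub> \<one>\<^bsub>mpoly_ring V\<^esub>) * f"
      using P.l_minus[OF P.one_closed, of f] that carr by (auto simp: mpoly_ring_simps)
    then show ?thesis
      using mult[OF P.a_inv_closed[OF P.one_closed] that] by simp
  qed
  show ?thesis
  proof (rule idealI)
    show "ring (mpoly_ring V :: ('v, 'k) mpoly ring)" ..
    show "subgroup J (add_monoid (mpoly_ring V))"
      by (rule P.add.subgroupI)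
        (use carr zero minus add in \<open>auto simp: mpoly_ring_simps a_inv_def\<close>)
    fix f g :: "('v, 'k) mpoly"
    assume *: "f \<in> J" "g \<in> carrier (mpoly_ring V)"
    show "g \<otimes>\<^bsub>mpoly_ring V\<^esub> f \<in> J"
      using mult[OF *(2,1)] by (simp add: mpoly_ring_simps)
    then show "f \<otimes>\<^bsub>mpoly_ring V\<^esub> g \<in> J"
      by (simp add: mpoly_ring_simps ac_simps)
  qed
qed

text \<open>
  This is the \<open>r\<close>-th power of the ideal \<open>(x_0, ..., x_N)\<close>. Described by its support, it is visibly
  multiplicative in \<open>r\<close>; the rule \<open>irrelevant_power_subsetI\<close> supplies the description by
  generators.
\<close>

definition irrelevant_power :: "nat \<Rightarrow> nat \<Rightarrow> (nat, 'k::field) mpoly set"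
  where "irrelevant_power N r = {f \<in> carrier (mpoly_ring {..N}).
    \<forall>m \<in> Poly_Mapping.keys f. r \<le> (\<Sum>i\<le>N. Poly_Mapping.lookup m i)}"

lemma irrelevant_power_mult:
  fixes f g :: "(nat, 'k::field) mpoly"
  assumes "f \<in> irrelevant_power N r" "g \<in> irrelevant_power N s"
  shows "f * g \<in> irrelevant_power N (r + s)"
proof -
  have "r + s \<le> (\<Sum>i\<le>N. Poly_Mapping.lookup m i)" if "m \<in> Poly_Mapping.keys (f * g)" for m
  proof -
    obtain a b where "m = a + b" "a \<in> Poly_Mapping.keys f" "b \<in> Poly_Mapping.keys g"
      using keys_mult[of f g] \<open>m \<in> Poly_Mapping.keys (f * g)\<close> by blast
    then show ?thesis
      using assms by (auto simp: irrelevant_power_def lookup_add sum.distrib intro!: add_mono)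
  qed
  then show ?thesis
    using assms by (auto simp: irrelevant_power_def intro: mpoly_ring_closed)
qed

lemma irrelevant_power_0: "irrelevant_power N 0 = carrier (mpoly_ring {..N})"
  by (auto simp: irrelevant_power_def)

lemma irrelevant_power_ideal: "ideal (irrelevant_power N r :: (nat, 'k::field) mpoly set) (mpoly_ring {..N})"
proof (rule mpoly_ring_idealI)
  fix f g :: "(nat, 'k) mpoly"
  show "f + g \<in> irrelevant_power N r" if "f \<in> irrelevant_power N r" "g \<in> irrelevant_power N r"
    using that keys_add[of f g] mpoly_ring_closed(1)[of f "{..N}" g]
    by (fastforce simp: irrelevant_power_def)
  show "f * g \<in> irrelevant_power N r" if "f \<in> carrier (mpoly_ring {..N})" "g \<in> irrelevant_power N r"
    using irrelevant_power_mult[of f N 0 g r] that by (simp add: irrelevant_power_0)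
qed (auto simp: irrelevant_power_def mpoly_ring_def)

lemma var_in_irrelevant_power: "i \<le> N \<Longrightarrow> var i \<in> irrelevant_power N 1"
  by (auto simp: irrelevant_power_def var_in_carrier)
     (auto simp: var_def lookup_single when_def sum.delta)

lemma sum_squares_in_irrelevant_power:
  "(\<Sum>i\<le>N. var i ^ 2) \<in> (irrelevant_power N 1 :: (nat, 'k::field) mpoly set)"
proof -
  note cl = mpoly_ideal_closed[OF irrelevant_power_ideal[of N 1, where 'k='k]]
  show ?thesis
    unfolding power2_eq_square
    by (rule cl(6), rule cl(5)) (simp_all add: var_in_carrier var_in_irrelevant_power del: One_nat_def)
qed

text \<open>
  The ideal \<open>(x_0, ..., x_N)^r\<close> is spanned by monomials, and a monomial of positive degree is a
  variable times a monomial of smaller degree. So a family of ideals contains the powers of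
  \<open>(x_0, ..., x_N)\<close> as soon as it starts with the unit ideal and multiplication by a variable
  leads from each member to the next.
\<close>

lemma irrelevant_power_subsetI:
  fixes J :: "nat \<Rightarrow> (nat, 'k::field) mpoly set"
  assumes ideal: "\<And>r. ideal (J r) (mpoly_ring {..N})"
    and one: "1 \<in> J 0"
    and step: "\<And>r i f. i \<le> N \<Longrightarrow> f \<in> J r \<Longrightarrow> var i * f \<in> J (Suc r)"
  shows "irrelevant_power N r \<subseteq> J r"
proof
  have single: "Poly_Mapping.single m 1 \<in> J r"
    if "Poly_Mapping.keys m \<subseteq> {..N}" "r \<le> (\<Sum>i\<le>N. Poly_Mapping.lookup m i)" for m
    using that
  proof (induction r arbitrary: m)
    case 0
    then show ?case
      using mpoly_ideal_closed(5)[OF ideal mpoly_ring_closed(5) one, of m 1] by simp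
  next
    case (Suc r)
    then obtain i where i: "i \<le> N" "Poly_Mapping.lookup m i \<noteq> 0"
      by (metis atMost_iff not_less_eq_eq sum.neutral zero_le)
    define m' where "m' = m - Poly_Mapping.single i 1"
    have m: "m = Poly_Mapping.single i 1 + m'"
      by (rule poly_mapping_eqI)
        (use i in \<open>auto simp: m'_def lookup_add lookup_minus lookup_single when_def\<close>)
    have "(\<Sum>j\<le>N. Poly_Mapping.lookup m j) = 1 + (\<Sum>j\<le>N. Poly_Mapping.lookup m' j)"
      using i by (subst m) (simp add: lookup_add sum.distrib lookup_single when_def)
    moreover have "Poly_Mapping.keys m' \<subseteq> {..N}"
      using Suc.prems(1) i(1) keys_diff[of m "Poly_Mapping.single i 1"]
      by (force simp: m in_keys_iff lookup_add subset_iff)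
    ultimately have "var i * Poly_Mapping.single m' 1 \<in> J (Suc r)"
      using Suc i by (intro step) auto
    then show ?case
      by (simp add: var_def mult_single m)
  qed
  fix f :: "(nat, 'k) mpoly"
  assume f: "f \<in> irrelevant_power N r"
  have "Poly_Mapping.single 0 (Poly_Mapping.lookup f m) * Poly_Mapping.single m 1 \<in> J r"
    if "m \<in> Poly_Mapping.keys f" for m
    using that f
    by (intro mpoly_ideal_closed(5)[OF ideal] mpoly_ring_closed single)
       (auto simp: irrelevant_power_def mpoly_ring_def)
  then show "f \<in> J r"
    by (subst sum_single_keys) (auto simp: mult_single intro!: mpoly_ideal_closed(6)[OF ideal])
qed

section \<open>Membership of monomials of large degree\<close>

text \<open>
  Modulo \<open>J\<close> a factor \<open>w z\<close> may be replaced by \<open>- u v - t\<close>. In the application \<open>u, v, w, z\<close> have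
  degree \<open>1\<close> and \<open>t\<close> is a quadratic form in other variables, so the part with \<open>t\<close> keeps the total
  degree and moves two units of it to \<open>t h\<close>. By \<open>higher\<close> this part is already known to lie in \<open>J\<close>;
  only the trade of \<open>w z\<close> for \<open>u v\<close> remains, and it can be repeated \<open>j\<close> times.
\<close>

lemma hyperbolic_exchange:
  fixes u v w z t h :: "('v, 'k::field) mpoly"
  assumes ideal: "ideal J (mpoly_ring V)"
    and carr: "u \<in> carrier (mpoly_ring V)" "v \<in> carrier (mpoly_ring V)"
      "w \<in> carrier (mpoly_ring V)" "z \<in> carrier (mpoly_ring V)" "h \<in> carrier (mpoly_ring V)"
    and rel: "u * v + w * z + t \<in> J"
    and higher: "\<And>a b c d. D \<le> a + b + c + d + 2 \<Longrightarrow> u ^ a * v ^ b * w ^ c * z ^ d * (t * h) \<in> J"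
    and deg: "D \<le> a + b + c + d + 2 * j"
    and mem: "u ^ (a + j) * v ^ (b + j) * w ^ c * z ^ d * h \<in> J"
  shows "u ^ a * v ^ b * w ^ (c + j) * z ^ (d + j) * h \<in> J"
  using deg mem
proof (induction j arbitrary: a b)
  case 0
  then show ?case by simp
next
  case (Suc j)
  note cl = mpoly_ideal_closed[OF ideal]
  let ?g = "u ^ a * v ^ b * w ^ (c + j) * z ^ (d + j)"
  have "?g * h * (u * v + w * z + t) \<in> J"
    by (intro cl(5) rel mpoly_ring_closed carr)
  moreover have "?g * (t * h) \<in> J"
    using Suc.prems(1) by (intro higher) simp
  moreover have "u ^ (a + 1) * v ^ (b + 1) * w ^ (c + j) * z ^ (d + j) * h \<in> J"
    using Suc.prems by (intro Suc.IH) (simp_all add: add_ac)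
  ultimately have "?g * h * (u * v + w * z + t) - ?g * (t * h) -
      u ^ (a + 1) * v ^ (b + 1) * w ^ (c + j) * z ^ (d + j) * h \<in> J"
    by (intro cl(4))
  also have "?g * h * (u * v + w * z + t) - ?g * (t * h) -
      u ^ (a + 1) * v ^ (b + 1) * w ^ (c + j) * z ^ (d + j) * h =
      u ^ a * v ^ b * w ^ (c + Suc j) * z ^ (d + Suc j) * h"
    by (simp add: algebra_simps)
  finally show ?case .
qed

text \<open>
  Trading as many factors as possible, in one of the two directions, brings some exponent up to \<open>q\<close>.
\<close>

lemma hyperbolic_monomial_in_ideal:
  fixes u v w z t h :: "('v, 'k::field) mpoly"
  assumes ideal: "ideal J (mpoly_ring V)"
    and carr: "u \<in> carrier (mpoly_ring V)" "v \<in> carrier (mpoly_ring V)"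
      "w \<in> carrier (mpoly_ring V)" "z \<in> carrier (mpoly_ring V)" "h \<in> carrier (mpoly_ring V)"
    and pow: "u ^ q \<in> J" "v ^ q \<in> J" "w ^ q \<in> J" "z ^ q \<in> J"
    and rel: "u * v + w * z + t \<in> J"
    and higher: "\<And>a b c d. D \<le> a + b + c + d + 2 \<Longrightarrow> u ^ a * v ^ b * w ^ c * z ^ d * (t * h) \<in> J"
    and deg: "D \<le> a + b + c + d" "2 * q \<le> Suc D"
  shows "u ^ a * v ^ b * w ^ c * z ^ d * h \<in> J"
proof -
  note cl = mpoly_ideal_closed[OF ideal]
  have large: "u ^ a * v ^ b * w ^ c * z ^ d * h \<in> J" if "q \<le> a \<or> q \<le> b \<or> q \<le> c \<or> q \<le> d"
    for a b c d
  proof -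
    have *: "x ^ k * f \<in> J" if "x \<in> carrier (mpoly_ring V)" "f \<in> carrier (mpoly_ring V)" "x ^ q \<in> J" "q \<le> k"
      for x f :: "('v, 'k) mpoly" and k
    proof -
      have "x ^ k * f = x ^ (k - q) * f * x ^ q"
        using \<open>q \<le> k\<close> le_add_diff_inverse2[of q k] power_add[of x "k - q" q] by (simp add: mult_ac)
      then show ?thesis
        using that by (simp add: cl(5) mpoly_ring_closed)
    qed
    have "u ^ a * (v ^ b * w ^ c * z ^ d * h) \<in> J \<or> v ^ b * (u ^ a * w ^ c * z ^ d * h) \<in> J \<or>
        w ^ c * (u ^ a * v ^ b * z ^ d * h) \<in> J \<or> z ^ d * (u ^ a * v ^ b * w ^ c * h) \<in> J"
      using that by (elim disjE) (simp_all add: * carr pow mpoly_ring_closed)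
    then show ?thesis
      by (simp add: mult_ac)
  qed
  \<comment> \<open>The two exchanges produce an exponent \<open>max a b + min c d\<close> and an exponent
      \<open>max c d + min a b\<close>; they add up to at least \<open>2q - 1\<close>, so one of them reaches \<open>q\<close>.\<close>
  define i j where "i = min a b" and "j = min c d"
  consider "q \<le> a + j \<or> q \<le> b + j" | "q \<le> c + i \<or> q \<le> d + i"
    using deg by (fastforce simp: i_def j_def min_def split: if_splits)
  then show ?thesis
  proof cases
    case 1
    have "u ^ a * v ^ b * w ^ (c - j + j) * z ^ (d - j + j) * h \<in> J"
    proof (rule hyperbolic_exchange[OF ideal carr rel higher])
      show "D \<le> a + b + (c - j) + (d - j) + 2 * j"
        using deg by (simp add: j_def)
      show "u ^ (a + j) * v ^ (b + j) * w ^ (c - j) * z ^ (d - j) * h \<in> J"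
        by (rule large) (use 1 in auto)
    qed
    then show ?thesis
      by (simp add: j_def)
  next
    case 2
    have "w ^ c * z ^ d * u ^ (a - i + i) * v ^ (b - i + i) * h \<in> J"
    proof (rule hyperbolic_exchange[OF ideal carr(3,4,1,2,5)])
      show "w * z + u * v + t \<in> J"
        using rel by (simp add: add.commute)
      show "w ^ a * z ^ b * u ^ c * v ^ d * (t * h) \<in> J" if "D \<le> a + b + c + d + 2" for a b c d
        using higher[of c d a b] that by (simp add: ac_simps)
      show "D \<le> c + d + (a - i) + (b - i) + 2 * i"
        using deg by (simp add: i_def)
      have "u ^ (a - i) * v ^ (b - i) * w ^ (c + i) * z ^ (d + i) * h \<in> J"
        by (rule large) (use 2 in auto)
      then show "w ^ (c + i) * z ^ (d + i) * u ^ (a - i) * v ^ (b - i) * h \<in> J"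
        by (simp add: mult_ac)
    qed
    then show ?thesis
      by (simp add: i_def mult_ac)
  qed
qed

text \<open>
  Descending induction on the degree of the part in \<open>x_4, ..., x_N\<close>. If that degree exceeds
  \<open>(N - 3) (q - 1)\<close>, a single exponent is at least \<open>q\<close>. Otherwise at least \<open>2 q - 1\<close> is left for
  \<open>u, v, w, z\<close>, and the previous lemma applies with \<open>t = x_4^2 + ... + x_N^2\<close>, whose terms
  increase the degree in \<open>x_4, ..., x_N\<close> by \<open>2\<close>.
\<close>

lemma hyperbolic_tail_monomial_in_ideal:
  fixes u v w z :: "(nat, 'k::field) mpoly"
  assumes ideal: "ideal J (mpoly_ring {..N})"
    and carr: "u \<in> carrier (mpoly_ring {..N})" "v \<in> carrier (mpoly_ring {..N})"
      "w \<in> carrier (mpoly_ring {..N})" "z \<in> carrier (mpoly_ring {..N})"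
    and pow: "u ^ q \<in> J" "v ^ q \<in> J" "w ^ q \<in> J" "z ^ q \<in> J"
    and var_pow: "\<And>i. i \<in> {4..N} \<Longrightarrow> var i ^ q \<in> J"
    and rel: "u * v + w * z + (\<Sum>i=4..N. var i ^ 2) \<in> J"
    and N: "N \<ge> 3" and q: "q > 0"
    and m: "Poly_Mapping.keys m \<subseteq> {4..N}"
    and deg: "(N - 1) * (q - 1) + 1 \<le> a + b + c + d + (\<Sum>i=4..N. Poly_Mapping.lookup m i)"
  shows "u ^ a * v ^ b * w ^ c * z ^ d * Poly_Mapping.single m 1 \<in> J"
  using m deg
proof (induction "(N - 3) * q - (\<Sum>i=4..N. Poly_Mapping.lookup m i)" arbitrary: a b c d m rule: less_induct)
  case less
  note cl = mpoly_ideal_closed[OF ideal]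
  let ?deg = "\<lambda>m. \<Sum>i=4..N. Poly_Mapping.lookup m i"
  have h: "Poly_Mapping.single m 1 \<in> carrier (mpoly_ring {..N} :: (nat, 'k) mpoly ring)"
    using less.prems by (intro mpoly_ring_closed) auto
  show ?case
  proof (cases "?deg m \<le> (N - 3) * (q - 1)")
    case False
    then obtain i where i: "i \<in> {4..N}" "q \<le> Poly_Mapping.lookup m i"
      using sum_bounded_above[of "{4..N}" "Poly_Mapping.lookup m" "q - 1"] q
      by (force simp: not_le)
    define m' where "m' = m - Poly_Mapping.single i q"
    have m': "m = m' + Poly_Mapping.single i q"
      by (rule poly_mapping_eqI)
        (use i in \<open>auto simp: m'_def lookup_add lookup_minus lookup_single when_def\<close>)
    have "Poly_Mapping.keys m' \<subseteq> {..N}"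
      using less.prems(1) by (force simp: m' in_keys_iff lookup_add subset_iff)
    then have "u ^ a * v ^ b * w ^ c * z ^ d * Poly_Mapping.single m' 1 * var i ^ q \<in> J"
      using i by (intro cl(5) var_pow mpoly_ring_closed carr)
    then show ?thesis
      by (simp add: m' var_power mult_single mult.assoc)
  next
    case True
    have "N - 1 = N - 3 + 2"
      using N by simp
    then have "(N - 1) * (q - 1) = (N - 3) * (q - 1) + 2 * (q - 1)"
      by (simp only: add_mult_distrib)
    with True less.prems(2) have "2 * (q - 1) + 1 \<le> a + b + c + d"
      by linarith
    then have big: "2 * q \<le> Suc (a + b + c + d)"
      using q by linarith
    show ?thesis
    proof (rule hyperbolic_monomial_in_ideal[OF ideal carr h pow rel _ order_refl big])
      fix a' b' c' d' :: nat
      assume deg': "a + b + c + d \<le> a' + b' + c' + d' + 2"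
      have "u ^ a' * v ^ b' * w ^ c' * z ^ d' * (var i ^ 2 * Poly_Mapping.single m 1) \<in> J"
        if i: "i \<in> {4..N}" for i
      proof -
        define m' where "m' = Poly_Mapping.single i 2 + m"
        have "?deg m' = ?deg m + 2"
          using i by (simp add: m'_def lookup_add lookup_single sum.distrib when_def)
        moreover have "?deg m < (N - 3) * q"
          by (rule le_less_trans[OF True]) (use i q in simp)
        moreover have "Poly_Mapping.keys m' \<subseteq> {4..N}"
          using less.prems(1) i keys_add[of "Poly_Mapping.single i 2" m] by (force simp: m'_def)
        ultimately have "u ^ a' * v ^ b' * w ^ c' * z ^ d' * Poly_Mapping.single m' 1 \<in> J"
          using less.prems(2) deg' by (intro less.hyps) auto
        then show ?thesis
          by (simp add: m'_def var_power mult_single)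
      qed
      then show "u ^ a' * v ^ b' * w ^ c' * z ^ d' *
          ((\<Sum>i=4..N. var i ^ 2) * Poly_Mapping.single m 1) \<in> J"
        unfolding sum_distrib_left sum_distrib_right by (intro cl(6))
    qed
  qed
qed

text \<open>
  The bound for monomials in \<open>u, v, w, z, x_4, ..., x_N\<close> is carried over to all forms. No change of
  variables is performed: \<open>K r\<close> collects the polynomials whose product with every such monomial
  of degree at least \<open>T - r\<close> lies in \<open>J\<close>. Each \<open>x_i\<close> is a linear combination of the new generators,
  so multiplication by \<open>x_i\<close> maps \<open>K r\<close> to \<open>K (r + 1)\<close>, and \<open>K T\<close> is contained in \<open>J\<close>.
\<close>

lemma irrelevant_power_subset_ideal:
  fixes J :: "(nat, 'k::field) mpoly set"
  assumes ideal: "ideal J (mpoly_ring {..N})"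
    and char: "prime CHAR('k)" "CHAR('k) > 2"
    and N: "N \<ge> 3" and q: "q > 0"
    and quadric: "(\<Sum>i\<le>N. var i ^ 2) \<in> J"
    and pow: "\<And>f. f \<in> irrelevant_power N 1 \<Longrightarrow> f ^ q \<in> J"
  shows "irrelevant_power N ((N - 1) * (q - 1) + 1) \<subseteq> J"
proof -
  note cl = mpoly_ideal_closed[OF ideal]
  define T where "T = (N - 1) * (q - 1) + 1"
  let ?C = "carrier (mpoly_ring {..N} :: (nat, 'k) mpoly ring)"
  let ?c = "Poly_Mapping.single 0 :: 'k \<Rightarrow> (nat, 'k) mpoly"
  obtain \<alpha> \<beta> :: 'k where \<alpha>\<beta>: "\<alpha>\<^sup>2 + \<beta>\<^sup>2 = -1"
    using neg_one_sum_of_two_squares[OF char] by blast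
  define A B where "A = ?c \<alpha>" and "B = ?c \<beta>"
  have AB: "A * A + B * B = -1"
    using \<alpha>\<beta> by (simp add: A_def B_def mult_single power2_eq_square single_uminus flip: single_add)
  \<comment> \<open>The rotated and scaled forms satisfy \<open>P^2 + R^2 = - x_2^2 - x_3^2\<close>, so the four squares become
      the differences of squares \<open>x_0^2 - P^2\<close> and \<open>x_1^2 - R^2\<close>.\<close>
  define P R where "P = A * var 2 + B * var 3" and "R = B * var 2 - A * var 3"
  define u v w z where "u = var 0 - P" and "v = var 0 + P" and "w = var 1 - R" and "z = var 1 + R"
  have const: "?c x \<in> ?C" for x
    by (intro mpoly_ring_closed) simp
  have var0123: "var 0 \<in> irrelevant_power N 1" "var 1 \<in> irrelevant_power N 1"
    "var 2 \<in> irrelevant_power N 1" "var 3 \<in> irrelevant_power N 1"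
    using N by (auto intro!: var_in_irrelevant_power simp del: One_nat_def)
  note cl1 = mpoly_ideal_closed[OF irrelevant_power_ideal[of N 1, where 'k='k]]
  have PR: "P \<in> irrelevant_power N 1" "R \<in> irrelevant_power N 1"
    unfolding P_def R_def A_def B_def by (intro cl1(3-5) const var0123)+
  have uvwz: "u \<in> irrelevant_power N 1" "v \<in> irrelevant_power N 1"
    "w \<in> irrelevant_power N 1" "z \<in> irrelevant_power N 1"
    unfolding u_def v_def w_def z_def by (intro cl1(3,4) var0123 PR)+
  note carr = uvwz[THEN cl1(2)]
  have hyperbolic: "u * v + w * z = (\<Sum>i<4. var i ^ 2)"
  proof -
    have "P * P + R * R = (A * A + B * B) * (var 2 * var 2 + var 3 * var 3)"
      by (simp add: P_def R_def algebra_simps)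
    then have "P * P + R * R = - (var 2 * var 2 + var 3 * var 3)"
      unfolding AB by simp
    moreover have "u * v + w * z = var 0 * var 0 + var 1 * var 1 - (P * P + R * R)"
      by (simp add: u_def v_def w_def z_def algebra_simps)
    ultimately have "u * v + w * z = var 0 * var 0 + var 1 * var 1 + (var 2 * var 2 + var 3 * var 3)"
      by simp
    then show ?thesis
      by (simp add: lessThan_nat_numeral lessThan_Suc power2_eq_square ac_simps)
  qed
  have "{..N} = {..<4} \<union> {4..N}"
    using N by auto
  then have rel: "u * v + w * z + (\<Sum>i=4..N. var i ^ 2) \<in> J"
    using quadric unfolding hyperbolic by (simp add: sum.union_disjoint ivl_disj_int)
  have half: "?c (1 / 2) * 2 = 1"
  proof -
    have "(2 :: 'k) \<noteq> 0"
      using char of_nat_eq_0_iff_char_dvd[of 2, where 'a='k] by (auto dest: dvd_imp_le)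
    moreover have "(2 :: (nat, 'k) mpoly) = ?c 2"
      by (rule single_numeral[symmetric])
    ultimately show ?thesis
      by (simp only: mult_single) simp
  qed
  define Mon where "Mon = (\<lambda>t. {u ^ a * v ^ b * w ^ c * z ^ d * Poly_Mapping.single m 1 | a b c d m.
    Poly_Mapping.keys m \<subseteq> {4..N} \<and> t \<le> a + b + c + d + (\<Sum>i=4..N. Poly_Mapping.lookup m i)})"
  have Mon_carrier: "g \<in> ?C" if "g \<in> Mon t" for g t
    using that carr by (fastforce simp: Mon_def intro!: mpoly_ring_closed)
  have Mon_mult: "l * g \<in> Mon (Suc t)"
    if g: "g \<in> Mon t" and l: "l \<in> {u, v, w, z} \<union> var ` {4..N}" for l g t
  proof -
    obtain a b c d m where m: "Poly_Mapping.keys m \<subseteq> {4..N}"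
      "t \<le> a + b + c + d + (\<Sum>i=4..N. Poly_Mapping.lookup m i)"
      and g: "g = u ^ a * v ^ b * w ^ c * z ^ d * Poly_Mapping.single m 1"
      using g by (auto simp: Mon_def)
    have MonI: "l * g \<in> Mon (Suc t)"
      if "l * g = u ^ a' * v ^ b' * w ^ c' * z ^ d' * Poly_Mapping.single m' 1"
        "Poly_Mapping.keys m' \<subseteq> {4..N}"
        "Suc t \<le> a' + b' + c' + d' + (\<Sum>i=4..N. Poly_Mapping.lookup m' i)" for a' b' c' d' m'
      using that unfolding Mon_def by blast
    consider "l = u" | "l = v" | "l = w" | "l = z" | i where "l = var i" "i \<in> {4..N}"
      using l by blast
    then show ?thesis
    proof cases
      case 1
      then show ?thesis using m by (intro MonI[of "Suc a" b c d m]) (simp_all add: g mult_ac)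
    next
      case 2
      then show ?thesis using m by (intro MonI[of a "Suc b" c d m]) (simp_all add: g mult_ac)
    next
      case 3
      then show ?thesis using m by (intro MonI[of a b "Suc c" d m]) (simp_all add: g mult_ac)
    next
      case 4
      then show ?thesis using m by (intro MonI[of a b c "Suc d" m]) (simp_all add: g mult_ac)
    next
      case (5 i)
      show ?thesis
      proof (rule MonI[of a b c d "Poly_Mapping.single i 1 + m"])
        show "l * g = u ^ a * v ^ b * w ^ c * z ^ d * Poly_Mapping.single (Poly_Mapping.single i 1 + m) 1"
          by (simp add: g 5(1) var_def mult_single mult.left_commute)
        show "Poly_Mapping.keys (Poly_Mapping.single i 1 + m) \<subseteq> {4..N}"
          using m(1) 5(2) keys_add[of "Poly_Mapping.single i 1" m] by force
        show "Suc t \<le> a + b + c + d + (\<Sum>j=4..N. Poly_Mapping.lookup (Poly_Mapping.single i 1 + m) j)"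
          using m(2) 5(2) by (simp add: lookup_add lookup_single sum.distrib when_def)
      qed
    qed
  qed
  define K where "K = (\<lambda>r. {f \<in> ?C. \<forall>t. T \<le> r + t \<longrightarrow> (\<forall>g \<in> Mon t. g * f \<in> J)})"
  have "irrelevant_power N T \<subseteq> K T"
  proof (rule irrelevant_power_subsetI)
    show "ideal (K r) (mpoly_ring {..N})" for r
    proof (rule mpoly_ring_idealI)
      show "0 \<in> K r"
        using cl(1) const[of 0] by (simp add: K_def)
      show "f + g \<in> K r" if "f \<in> K r" "g \<in> K r" for f g
        using that by (auto simp: K_def distrib_left intro: mpoly_ring_closed cl(3))
      show "f * g \<in> K r" if "f \<in> ?C" "g \<in> K r" for f g
        using that cl(5)[of f] by (auto simp: K_def mult.left_commute[of _ f] intro: mpoly_ring_closed)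
    qed (auto simp: K_def)
    have "u ^ a * v ^ b * w ^ c * z ^ d * Poly_Mapping.single m 1 \<in> J"
      if "Poly_Mapping.keys m \<subseteq> {4..N}"
        "T \<le> a + b + c + d + (\<Sum>i=4..N. Poly_Mapping.lookup m i)" for a b c d m
      using that N q var_in_irrelevant_power[of _ N]
      by (intro hyperbolic_tail_monomial_in_ideal[OF ideal carr uvwz[THEN pow]] rel pow)
         (auto simp: T_def)
    then show "1 \<in> K 0"
      using const[of 1] by (fastforce simp: K_def Mon_def)
  next
    fix r i and f :: "(nat, 'k) mpoly"
    assume i: "i \<le> N" and f: "f \<in> K r"
    have "g * (var i * f) \<in> J" if t: "T \<le> Suc r + t" and g: "g \<in> Mon t" for t g
    proof -
      define L where "L = {l \<in> ?C. l * g * f \<in> J}"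
      have gen: "l \<in> L" if "l \<in> {u, v, w, z} \<union> var ` {4..N}" for l
      proof -
        have "l \<in> ?C"
          using that carr by (auto simp: var_in_carrier)
        moreover have "l * g * f \<in> J"
          using f Mon_mult[OF g that] t unfolding K_def mem_Collect_eq by (metis add_Suc_shift)
        ultimately show ?thesis
          by (simp add: L_def)
      qed
      have lin: "k + l \<in> L" "k - l \<in> L" if "k \<in> L" "l \<in> L" for k l
      proof -
        have "k * g * f + l * g * f \<in> J" "k * g * f - l * g * f \<in> J"
          using that by (auto simp: L_def intro!: cl(3,4))
        then show "k + l \<in> L" "k - l \<in> L"
          using that by (auto simp: L_def algebra_simps intro: mpoly_ring_closed)
      qed
      have scale: "?c x * l \<in> L" if "l \<in> L" for l x
      proof -
        have "?c x * (l * g * f) \<in> J"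
          using that by (auto simp: L_def intro!: cl(5) const)
        then show ?thesis
          using that const[of x] by (auto simp: L_def mult.assoc intro: mpoly_ring_closed)
      qed
      have "?c (1 / 2) * (v - u) \<in> L" "?c (1 / 2) * (u + v) \<in> L"
        "?c (1 / 2) * (z - w) \<in> L" "?c (1 / 2) * (w + z) \<in> L"
        by (intro scale lin gen; simp)+
      then have P: "P \<in> L" and x0: "var 0 \<in> L" and R: "R \<in> L" and x1: "var 1 \<in> L"
        by (simp_all add: u_def v_def w_def z_def half flip: mult.assoc mult_2)
      \<comment> \<open>Up to sign, the symmetric matrix that defines \<open>P\<close> and \<open>R\<close> is its own inverse.\<close>
      have "- (A * P + B * R) = - ((A * A + B * B) * var 2)"
        "A * R - B * P = - ((A * A + B * B) * var 3)"
        by (simp_all add: P_def R_def algebra_simps)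
      then have "var 2 = ?c (-1) * (A * P + B * R)" "var 3 = A * R - B * P"
        unfolding AB by (simp_all add: single_uminus)
      then have x2: "var 2 \<in> L" and x3: "var 3 \<in> L"
        unfolding A_def B_def by (simp_all only: scale lin P R)
      have "i = 0 \<or> i = 1 \<or> i = 2 \<or> i = 3 \<or> i \<in> {4..N}"
        using i by auto
      then have "var i \<in> L"
        using x0 x1 x2 x3 gen[of "var i"] by (elim disjE) auto
      then show ?thesis
        by (simp add: L_def mult_ac)
    qed
    then show "var i * f \<in> K (Suc r)"
      using i f by (auto simp: K_def var_in_carrier intro: mpoly_ring_closed)
  qed
  moreover have "1 \<in> Mon 0"
    by (auto simp: Mon_def intro!: exI[of _ 0])
  ultimately show ?thesis
    by (fastforce simp: K_def T_def)
qed

section \<open>A monomial outside the Frobenius power\<close>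

text \<open>
  This is the monomial ideal \<open>(x_0^q, ..., x_N^q)\<close>. A single coefficient on a monomial with all
  exponents below \<open>q\<close> certifies that a polynomial is not in it.
\<close>

definition bracket_ideal :: "nat \<Rightarrow> nat \<Rightarrow> (nat, 'k::field) mpoly set"
  where "bracket_ideal N q = {f \<in> carrier (mpoly_ring {..N}).
    \<forall>m \<in> Poly_Mapping.keys f. \<exists>i\<le>N. q \<le> Poly_Mapping.lookup m i}"

lemma bracket_ideal_ideal:
  "ideal (bracket_ideal N q :: (nat, 'k::field) mpoly set) (mpoly_ring {..N})"
proof (rule mpoly_ring_idealI)
  fix f g :: "(nat, 'k) mpoly"
  show "f + g \<in> bracket_ideal N q" if "f \<in> bracket_ideal N q" "g \<in> bracket_ideal N q"
    using that keys_add[of f g] by (force simp: bracket_ideal_def intro: mpoly_ring_closed)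
  show "f * g \<in> bracket_ideal N q" if fg: "f \<in> carrier (mpoly_ring {..N})" "g \<in> bracket_ideal N q"
  proof -
    have "\<exists>i\<le>N. q \<le> Poly_Mapping.lookup m i" if "m \<in> Poly_Mapping.keys (f * g)" for m
    proof -
      obtain a b where "m = a + b" "b \<in> Poly_Mapping.keys g"
        using keys_mult[of f g] \<open>m \<in> Poly_Mapping.keys (f * g)\<close> by blast
      then show ?thesis
        using fg(2) by (force simp: bracket_ideal_def lookup_add)
    qed
    then show ?thesis
      using fg by (auto simp: bracket_ideal_def intro: mpoly_ring_closed)
  qed
qed (auto simp: bracket_ideal_def mpoly_ring_def)

text \<open>
  In characteristic \<open>p\<close> the \<open>q\<close>-th power of a sum of monomials is the sum of their \<open>q\<close>-th powers.
\<close>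

lemma power_in_bracket_ideal:
  fixes f :: "(nat, 'k::field) mpoly"
  assumes "prime CHAR('k)" and f: "f \<in> irrelevant_power N 1"
  shows "f ^ (CHAR('k) ^ s) \<in> bracket_ideal N (CHAR('k) ^ s)"
proof -
  define q where "q = CHAR('k) ^ s"
  have "(Poly_Mapping.single m c :: (nat, 'k) mpoly) ^ q \<in> bracket_ideal N q"
    if m: "m \<in> Poly_Mapping.keys f" for m c
  proof -
    have "0 < (\<Sum>i\<le>N. Poly_Mapping.lookup m i)"
      using f m by (fastforce simp: irrelevant_power_def)
    then obtain i where i: "i \<le> N" "0 < Poly_Mapping.lookup m i"
      by (metis atMost_iff gr0I less_irrefl sum.neutral)
    have "Poly_Mapping.single m c ^ q \<in> carrier (mpoly_ring {..N})"
      using f m by (intro mpoly_ring_closed) (auto simp: irrelevant_power_def mpoly_ring_def)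
    moreover have "Poly_Mapping.lookup (\<Sum>j<q. m) i = q * Poly_Mapping.lookup m i"
      by (subst lookup_sum) simp
    ultimately show ?thesis
      using i by (auto simp del: sum_constant simp: bracket_ideal_def single_power intro!: exI[of _ i])
  qed
  then have "(\<Sum>m\<in>Poly_Mapping.keys f. Poly_Mapping.single m (Poly_Mapping.lookup f m) ^ q) \<in> bracket_ideal N q"
    by (intro mpoly_ideal_closed(6)[OF bracket_ideal_ideal])
  also have "(\<Sum>m\<in>Poly_Mapping.keys f. Poly_Mapping.single m (Poly_Mapping.lookup f m) ^ q) = f ^ q"
    using assms(1) by (subst (3) sum_single_keys) (simp add: freshmans_dream_sum' q_def CHAR_mpoly)
  finally show ?thesis
    by (simp add: q_def)
qed

text \<open>
  Multiplication by \<open>x_2^(q-1) ... x_N^(q-1)\<close> kills \<open>x_2^2, ..., x_N^2\<close> modulo \<open>(x_0^q, ..., x_N^q)\<close>,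
  which leaves the binomial expansion of \<open>(x_0^2 + x_1^2)^(q-1)\<close>. Only its middle term has both
  exponents below \<open>q\<close>.
\<close>

lemma sum_squares_power_times_socle_notin_bracket_ideal:
  assumes "prime CHAR('k::field)" "odd CHAR('k)" and N: "N \<ge> 1" and q: "q = CHAR('k) ^ s"
  shows "(\<Sum>i\<le>N. var i ^ 2) ^ (q - 1) * (\<Prod>i=2..N. var i ^ (q - 1))
    \<notin> (bracket_ideal N q :: (nat, 'k) mpoly set)"
proof
  note cl = mpoly_ideal_closed[OF bracket_ideal_ideal[of N q, where 'k='k]]
  define Q E F where "Q = (\<Sum>i\<le>N. var i ^ 2 :: (nat, 'k) mpoly)"
    and "E = (var 0 ^ 2 + var 1 ^ 2 :: (nat, 'k) mpoly)"
    and "F = (\<Prod>i=2..N. var i ^ (q - 1) :: (nat, 'k) mpoly)"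
  have q0: "q > 0" "odd q"
    using assms by (auto simp: prime_gt_0_nat)
  have single: "Poly_Mapping.single m c \<in> bracket_ideal N q \<longleftrightarrow>
      c = 0 \<or> Poly_Mapping.keys m \<subseteq> {..N} \<and> (\<exists>i\<le>N. q \<le> Poly_Mapping.lookup m i)"
    for m and c :: 'k
    by (auto simp: bracket_ideal_def mpoly_ring_def)
  have var_prod: "(\<Prod>i\<in>I. var i ^ k i) = (Poly_Mapping.single (\<Sum>i\<in>I. Poly_Mapping.single i (k i)) 1 :: (nat, 'k) mpoly)"
    for I and k :: "nat \<Rightarrow> nat"
    by (induction I rule: infinite_finite_induct) (simp_all add: var_power mult_single)
  have prod_carrier: "(\<Prod>i\<in>I. var i ^ k i) \<in> carrier (mpoly_ring {..N} :: (nat, 'k) mpoly ring)"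
    if "I \<subseteq> {..N}" for I and k :: "nat \<Rightarrow> nat"
    unfolding var_prod
    by (intro mpoly_ring_closed order_trans[OF keys_sum]) (use that in \<open>auto split: if_splits\<close>)
  have carr: "E \<in> carrier (mpoly_ring {..N})" "Q \<in> carrier (mpoly_ring {..N})" "F \<in> carrier (mpoly_ring {..N})"
  proof -
    show "E \<in> carrier (mpoly_ring {..N})"
      using N by (auto simp: E_def var_in_carrier intro!: mpoly_ring_closed)
    show "Q \<in> carrier (mpoly_ring {..N})"
      unfolding Q_def
      by (rule mpoly_ideal_closed(2)[OF irrelevant_power_ideal sum_squares_in_irrelevant_power])
    show "F \<in> carrier (mpoly_ring {..N})"
      unfolding F_def by (rule prod_carrier) auto
  qed
  have diff: "Q ^ k * F - E ^ k * F \<in> bracket_ideal N q" for k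
  proof (induction k)
    case 0
    then show ?case by (simp add: cl(1))
  next
    case (Suc k)
    have "var j ^ 2 * F \<in> bracket_ideal N q" if j: "j \<in> {2..N}" for j
    proof -
      have F: "F = var j ^ (q - 1) * (\<Prod>i\<in>{2..N} - {j}. var i ^ (q - 1))"
        unfolding F_def using j by (subst prod.remove[of _ j]) auto
      have "(\<Prod>i\<in>{2..N} - {j}. var i ^ (q - 1)) * var j * var j ^ q \<in> (bracket_ideal N q :: (nat, 'k) mpoly set)"
        using j by (intro cl(5) mpoly_ring_closed prod_carrier) (auto simp: var_in_carrier var_power single)
      moreover have "var j ^ 2 * F = (\<Prod>i\<in>{2..N} - {j}. var i ^ (q - 1)) * var j * var j ^ q"
        unfolding F using q0 by (cases q) (simp_all add: power2_eq_square mult_ac)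
      ultimately show ?thesis
        by simp
    qed
    then have "(\<Sum>j=2..N. var j ^ 2) * F \<in> bracket_ideal N q"
      unfolding sum_distrib_right by (rule cl(6))
    moreover have "Q = E + (\<Sum>j=2..N. var j ^ 2)"
    proof -
      have "{..N} = {0, 1} \<union> {2..N}"
        using N by auto
      then show ?thesis
        by (simp add: Q_def E_def sum.union_disjoint add.assoc)
    qed
    ultimately have "Q ^ k * ((Q - E) * F) + E * (Q ^ k * F - E ^ k * F) \<in> bracket_ideal N q"
      using Suc carr by (intro cl(3) cl(5)[of "Q ^ k"] cl(5)[of E] mpoly_ring_closed) simp_all
    then show ?case
      by (simp add: algebra_simps)
  qed
  assume "(\<Sum>i\<le>N. var i ^ 2) ^ (q - 1) * (\<Prod>i=2..N. var i ^ (q - 1)) \<in> (bracket_ideal N q :: (nat, 'k) mpoly set)"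
  then have "Q ^ (q - 1) * F \<in> bracket_ideal N q"
    by (simp only: Q_def F_def)
  from cl(4)[OF this diff[of "q - 1"]] have EF: "E ^ (q - 1) * F \<in> bracket_ideal N q"
    by simp
  define e where "e = (q - 1) div 2"
  have e: "q - 1 = 2 * e" "e < q"
    using q0 by (auto simp: e_def elim!: oddE)
  define t where "t = (\<lambda>k. of_nat (q - 1 choose k) * (var 0 ^ 2) ^ k * (var 1 ^ 2) ^ (q - 1 - k) * F)"
  have t: "t k = Poly_Mapping.single (Poly_Mapping.single 0 (2 * k) + Poly_Mapping.single 1 (2 * (q - 1 - k)) +
      (\<Sum>i=2..N. Poly_Mapping.single i (q - 1))) (of_nat (q - 1 choose k))" for k
    unfolding t_def F_def var_prod power_mult[symmetric] single_of_nat[symmetric]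
    by (simp only: var_power mult_single add_0 mult_1_right)
  have "t k \<in> bracket_ideal N q" if k: "k \<le> q - 1" "k \<noteq> e" for k
  proof -
    have carr_t: "t k \<in> carrier (mpoly_ring {..N})"
      unfolding t_def single_of_nat[symmetric]
      using N carr by (intro mpoly_ring_closed) (auto simp: var_in_carrier)
    have "q \<le> 2 * k \<or> q \<le> 2 * (q - 1 - k)"
      using k e by linarith
    then have "\<exists>i\<le>N. q \<le> Poly_Mapping.lookup (Poly_Mapping.single 0 (2 * k) +
        Poly_Mapping.single 1 (2 * (q - 1 - k)) + (\<Sum>i=2..N. Poly_Mapping.single i (q - 1))) i"
      using N by (elim disjE; intro exI[of _ 0] exI[of _ 1]; force simp: lookup_add lookup_single)
    with carr_t show ?thesis
      by (auto simp: t bracket_ideal_def)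
  qed
  then have "(\<Sum>k\<in>{..q - 1} - {e}. t k) \<in> bracket_ideal N q"
    by (intro cl(6)) auto
  moreover have "E ^ (q - 1) * F = (\<Sum>k\<le>q - 1. t k)"
    by (simp add: E_def t_def binomial_ring sum_distrib_right)
  moreover have "(\<Sum>k\<le>q - 1. t k) = t e + (\<Sum>k\<in>{..q - 1} - {e}. t k)"
    using e by (subst sum.remove[of _ e]) auto
  ultimately have "t e \<in> bracket_ideal N q"
    using EF cl(4)[of "E ^ (q - 1) * F" "(\<Sum>k\<in>{..q - 1} - {e}. t k)"] by simp
  moreover have "(of_nat (q - 1 choose e) :: 'k) \<noteq> 0"
    using prime_not_dvd_choose_prime_power_minus_1[of "CHAR('k)" e s] assms(1) e(2)
    by (simp add: q of_nat_eq_0_iff_char_dvd)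
  ultimately obtain i where "i \<le> N" "q \<le> Poly_Mapping.lookup (Poly_Mapping.single 0 (2 * e) + Poly_Mapping.single 1 (2 * (q - 1 - e)) +
      (\<Sum>i=2..N. Poly_Mapping.single i (q - 1))) i"
    unfolding t single by blast
  then show False
    using e q0 by (auto simp: lookup_add lookup_sum lookup_single when_def split: if_splits)
qed

section \<open>Passing to the quotient ring\<close>

text \<open>
  Ideals of the quotient ring correspond to ideals containing \<open>I\<close>, so questions about
  generated ideals in the quotient can be answered upstairs.
\<close>

lemma (in ring) coset_in_genideal_quotient_iff:
  assumes I: "ideal I R" and S: "S \<subseteq> carrier R" and x: "x \<in> carrier R"
  shows "I +> x \<in> Idl\<^bsub>R Quot I\<^esub> ((+>) I ` S) \<longleftrightarrow> x \<in> Idl (I \<union> S)"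
proof
  interpret Q: ring "R Quot I" by (rule ideal.quotient_is_ring[OF I])
  have sub: "I \<union> S \<subseteq> carrier R"
    using S ideal.Icarr[OF I] by blast
  have ideal: "ideal (Idl (I \<union> S)) R"
    by (rule genideal_ideal[OF sub])
  have cosets: "(+>) I ` S \<subseteq> carrier (R Quot I)"
    using S ring_hom_closed[OF ideal.rcos_ring_hom[OF I]] by blast
  show "I +> x \<in> Idl\<^bsub>R Quot I\<^esub> ((+>) I ` S)" if "x \<in> Idl (I \<union> S)"
  proof -
    let ?K = "{y \<in> carrier R. I +> y \<in> Idl\<^bsub>R Quot I\<^esub> ((+>) I ` S)}"
    have K: "ideal ?K R"
      by (intro ring_hom_ring.ideal_vimage[OF ideal.rcos_ring_hom_ring[OF I]] Q.genideal_ideal cosets)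
    have "I +> y \<in> Idl\<^bsub>R Quot I\<^esub> ((+>) I ` S)" if "y \<in> I" for y
      using additive_subgroup.zero_closed[OF ideal.axioms(1)[OF Q.genideal_ideal[OF cosets]]]
        abelian_subgroup.a_rcos_const[OF abelian_subgroupI3[OF ideal.axioms(1)[OF I] abelian_group_axioms] that]
      by (simp add: FactRing_def)
    then have "I \<union> S \<subseteq> ?K"
      using Q.genideal_self[OF cosets] sub by blast
    then show ?thesis
      using genideal_minimal[OF K] that by blast
  qed
  show "x \<in> Idl (I \<union> S)" if "I +> x \<in> Idl\<^bsub>R Quot I\<^esub> ((+>) I ` S)"
  proof -
    have "(+>) I ` S \<subseteq> (+>) I ` (Idl (I \<union> S))"
      using genideal_self[OF sub] by blast
    then have "I +> x \<in> (+>) I ` (Idl (I \<union> S))"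
      using Q.genideal_minimal[OF ring_ideal_imp_quot_ideal[OF I ideal]] that by blast
    then obtain y where y: "y \<in> Idl (I \<union> S)" "I +> x = I +> y"
      by blast
    have yc: "y \<in> carrier R"
      using y(1) ideal.Icarr[OF ideal] by blast
    then have "x \<ominus> y \<in> Idl (I \<union> S)"
      using quotient_eq_iff_same_a_r_cos[OF I x] y(2) genideal_self[OF sub] by blast
    then have "(x \<ominus> y) \<oplus> y \<in> Idl (I \<union> S)"
      using y(1) additive_subgroup.a_closed[OF ideal.axioms(1)[OF ideal]] by blast
    moreover have "(x \<ominus> y) \<oplus> y = x"
      using x yc by algebra
    ultimately show ?thesis
      by simp
  qed
qed

lemma quadric_ideal_ideal: "ideal (quadric_ideal TYPE('k::field) N) (mpoly_ring {..N})"
proof -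
  interpret P: cring "mpoly_ring {..N} :: (nat, 'k) mpoly ring" by (rule mpoly_ring_cring)
  have "(\<Sum>i\<le>N. var i ^ 2) \<in> carrier (mpoly_ring {..N} :: (nat, 'k) mpoly ring)"
    by (rule mpoly_ideal_closed(2)[OF irrelevant_power_ideal sum_squares_in_irrelevant_power])
  then show ?thesis
    unfolding quadric_ideal_def by (intro P.genideal_ideal) simp
qed

lemma sum_squares_in_quadric_ideal: "(\<Sum>i\<le>N. var i ^ 2) \<in> quadric_ideal TYPE('k::field) N"
  unfolding quadric_ideal_def genideal_def by blast

lemma quadric_ideal_subset_iff:
  assumes "ideal J (mpoly_ring {..N})"
  shows "quadric_ideal TYPE('k::field) N \<subseteq> J \<longleftrightarrow> (\<Sum>i\<le>N. var i ^ 2) \<in> J"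
proof
  interpret P: cring "mpoly_ring {..N} :: (nat, 'k) mpoly ring" by (rule mpoly_ring_cring)
  show "quadric_ideal TYPE('k) N \<subseteq> J" if "(\<Sum>i\<le>N. var i ^ 2) \<in> J"
    unfolding quadric_ideal_def using assms that by (intro P.genideal_minimal) auto
qed (use sum_squares_in_quadric_ideal in blast)

abbreviation quadric_coset :: "nat \<Rightarrow> (nat, 'k::field) mpoly \<Rightarrow> (nat, 'k) mpoly set"
  where "quadric_coset N \<equiv> a_r_coset (mpoly_ring {..N}) (quadric_ideal TYPE('k) N)"

text \<open>
  The inclusion from left to right holds because the images of the powers of \<open>(x_0, ..., x_N)\<close> are
  ideals that multiply accordingly; for the other one, the preimages of the powers of the maximal
  ideal are compatible with multiplication by variables.
\<close>

lemma quadric_max_ideal_power: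
  "quadric_max_ideal TYPE('k::field) N [^]\<^bsub>ideals_set (quadric_ring TYPE('k) N)\<^esub> (r::nat) =
    quadric_coset N ` irrelevant_power N r"
proof -
  let ?P = "mpoly_ring {..N} :: (nat, 'k) mpoly ring" and ?I = "quadric_ideal TYPE('k) N"
  let ?R = "quadric_ring TYPE('k) N" and ?M = "quadric_max_ideal TYPE('k) N"
  interpret P: cring ?P by (rule mpoly_ring_cring)
  interpret I: ideal ?I ?P by (rule quadric_ideal_ideal)
  interpret R: cring ?R
    unfolding quadric_ring_def by (rule I.quotient_is_cring) (rule P.is_cring)
  interpret h: ring_hom_ring ?P ?R "quadric_coset N"
    unfolding quadric_ring_def by (rule I.rcos_ring_hom_ring)
  have surj: "carrier ?R = quadric_coset N ` carrier ?P"
    unfolding quadric_ring_def FactRing_def A_RCOSETS_def' by (simp add: UNION_singleton_eq_range)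
  have M: "ideal ?M ?R"
    unfolding quadric_max_ideal_def by (rule R.genideal_ideal) (simp add: image_subset_iff var_in_carrier h.hom_closed)
  have var_M: "quadric_coset N (var i) \<in> ?M" if "i \<le> N" for i
  proof -
    have "quadric_coset N (var i) \<in> (\<lambda>i. quadric_coset N (var i)) ` {..N}"
      using that by simp
    moreover have "(\<lambda>i. quadric_coset N (var i)) ` {..N} \<subseteq> ?M"
      unfolding quadric_max_ideal_def
      by (rule R.genideal_self) (simp add: image_subset_iff var_in_carrier h.hom_closed)
    ultimately show ?thesis
      by (rule rev_subsetD)
  qed
  have power_ideal: "ideal (?M [^]\<^bsub>ideals_set ?R\<^esub> (r::nat)) ?R" for r
  proof (induction r)
    case 0
    then show ?case
      using R.oneideal by (simp add: nat_pow_def ideals_set_def)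
  next
    case (Suc r)
    then show ?case
      using R.ideal_prod_is_ideal[OF _ M] by (simp add: nat_pow_def ideals_set_def)
  qed
  have Suc_power: "?M [^]\<^bsub>ideals_set ?R\<^esub> Suc r = ideal_prod ?R (?M [^]\<^bsub>ideals_set ?R\<^esub> r) ?M" for r
    by (simp add: nat_pow_def ideals_set_def)
  have image_ideal: "ideal (quadric_coset N ` irrelevant_power N r) ?R" for r
    unfolding quadric_ring_def
    by (intro P.ring_ideal_imp_quot_ideal I.is_ideal irrelevant_power_ideal)
  have M_subset: "?M \<subseteq> quadric_coset N ` irrelevant_power N 1"
    unfolding quadric_max_ideal_def
    by (rule R.genideal_minimal[OF image_ideal]) (auto simp del: One_nat_def intro!: imageI var_in_irrelevant_power)
  show ?thesis
  proof
    show "?M [^]\<^bsub>ideals_set ?R\<^esub> r \<subseteq> quadric_coset N ` irrelevant_power N r"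
    proof (induction r)
      case 0
      then show ?case
        by (simp add: nat_pow_def ideals_set_def irrelevant_power_0 surj)
    next
      case (Suc r)
      have "x \<in> quadric_coset N ` irrelevant_power N (Suc r)"
        if "x \<in> ideal_prod ?R (?M [^]\<^bsub>ideals_set ?R\<^esub> r) ?M" for x
        using that
      proof (induction rule: ideal_prod.induct)
        case (prod a b)
        then obtain f g where fg: "f \<in> irrelevant_power N r" "g \<in> irrelevant_power N 1"
          "a = quadric_coset N f" "b = quadric_coset N g"
          using Suc.IH M_subset by blast
        then have "a \<otimes>\<^bsub>?R\<^esub> b = quadric_coset N (f * g)"
          using mpoly_ideal_closed(2)[OF irrelevant_power_ideal fg(1)]
            mpoly_ideal_closed(2)[OF irrelevant_power_ideal fg(2)] h.hom_mult[of f g]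
          by (simp add: mpoly_ring_simps)
        then show ?case
          using irrelevant_power_mult[OF fg(1,2)] by simp
      next
        case (sum a b)
        then show ?case
          by (intro additive_subgroup.a_closed[OF ideal.axioms(1)[OF image_ideal]])
      qed
      then show ?case
        unfolding Suc_power by blast
    qed
    define J where "J = (\<lambda>r. {f \<in> carrier ?P. quadric_coset N f \<in> ?M [^]\<^bsub>ideals_set ?R\<^esub> (r::nat)})"
    have "irrelevant_power N r \<subseteq> J r"
    proof (rule irrelevant_power_subsetI)
      show "ideal (J r) ?P" for r
        unfolding J_def by (rule h.ideal_vimage[OF power_ideal])
      show "1 \<in> J 0"
        using h.hom_closed[OF P.one_closed] P.one_closed
        by (simp add: J_def nat_pow_def ideals_set_def mpoly_ring_simps)
      show "var i * f \<in> J (Suc r)" if "i \<le> N" "f \<in> J r" for r i f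
      proof -
        have *: "f \<in> carrier ?P" "var i \<in> carrier ?P"
          using that by (auto simp: J_def var_in_carrier)
        then have "quadric_coset N (f * var i) = quadric_coset N f \<otimes>\<^bsub>?R\<^esub> quadric_coset N (var i)"
          using h.hom_mult[of f "var i"] by (simp add: mpoly_ring_simps)
        moreover have "\<dots> \<in> ?M [^]\<^bsub>ideals_set ?R\<^esub> Suc r"
          unfolding Suc_power using that var_M by (intro ideal_prod.prod) (auto simp: J_def)
        ultimately show ?thesis
          using * by (simp add: J_def mult.commute mpoly_ring_closed)
      qed
    qed
    then show "quadric_coset N ` irrelevant_power N r \<subseteq> ?M [^]\<^bsub>ideals_set ?R\<^esub> r"
      by (auto simp: J_def)
  qed
qed

text \<open>
  This is the preimage of \<open>m^[q]\<close> in the polynomial ring.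
\<close>

definition lifted_frobenius_power :: "nat \<Rightarrow> nat \<Rightarrow> (nat, 'k::field) mpoly set"
  where "lifted_frobenius_power N q = genideal (mpoly_ring {..N})
    (quadric_ideal TYPE('k) N \<union> (\<lambda>f. f ^ q) ` irrelevant_power N 1)"

lemma lifted_frobenius_power_ideal:
  "ideal (lifted_frobenius_power N q :: (nat, 'k::field) mpoly set) (mpoly_ring {..N})"
  and quadric_in_lifted_frobenius_power: "(\<Sum>i\<le>N. var i ^ 2) \<in> (lifted_frobenius_power N q :: (nat, 'k::field) mpoly set)"
  and power_in_lifted_frobenius_power: "f \<in> irrelevant_power N 1 \<Longrightarrow> f ^ q \<in> (lifted_frobenius_power N q :: (nat, 'k::field) mpoly set)"
  and lifted_frobenius_power_minimal: "ideal J (mpoly_ring {..N}) \<Longrightarrow> (\<Sum>i\<le>N. var i ^ 2) \<in> J \<Longrightarrow>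
     (\<And>f. f \<in> irrelevant_power N 1 \<Longrightarrow> f ^ q \<in> J) \<Longrightarrow> lifted_frobenius_power N q \<subseteq> (J :: (nat, 'k::field) mpoly set)"
proof -
  interpret P: cring "mpoly_ring {..N} :: (nat, 'k) mpoly ring" by (rule mpoly_ring_cring)
  have sub: "quadric_ideal TYPE('k) N \<union> (\<lambda>f. f ^ q) ` irrelevant_power N 1 \<subseteq> carrier (mpoly_ring {..N})"
    using mpoly_ideal_closed(2)[OF quadric_ideal_ideal, where 'k='k]
      mpoly_ideal_closed(2)[OF irrelevant_power_ideal, where 'k='k] by (auto intro!: mpoly_ring_closed(4))
  show "ideal (lifted_frobenius_power N q :: (nat, 'k) mpoly set) (mpoly_ring {..N})"
    unfolding lifted_frobenius_power_def by (rule P.genideal_ideal[OF sub])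
  show "(\<Sum>i\<le>N. var i ^ 2) \<in> (lifted_frobenius_power N q :: (nat, 'k) mpoly set)"
    unfolding lifted_frobenius_power_def using P.genideal_self[OF sub] sum_squares_in_quadric_ideal by blast
  show "f ^ q \<in> (lifted_frobenius_power N q :: (nat, 'k) mpoly set)" if "f \<in> irrelevant_power N 1" for f
    unfolding lifted_frobenius_power_def using P.genideal_self[OF sub] that by blast
  show "lifted_frobenius_power N q \<subseteq> J"
    if "ideal J (mpoly_ring {..N})" "(\<Sum>i\<le>N. var i ^ 2) \<in> J"
      "\<And>f. f \<in> irrelevant_power N 1 \<Longrightarrow> f ^ q \<in> J" for J :: "(nat, 'k) mpoly set"
    unfolding lifted_frobenius_power_def
    using that quadric_ideal_subset_iff[of J N] by (intro P.genideal_minimal) auto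
qed

lemma quadric_max_ideal_power_subset_frobenius_power_iff:
  "quadric_max_ideal TYPE('k::field) N [^]\<^bsub>ideals_set (quadric_ring TYPE('k) N)\<^esub> (r::nat) \<subseteq>
      frobenius_power (quadric_ring TYPE('k) N) (quadric_max_ideal TYPE('k) N) q \<longleftrightarrow>
    irrelevant_power N r \<subseteq> (lifted_frobenius_power N q :: (nat, 'k) mpoly set)"
proof -
  let ?P = "mpoly_ring {..N} :: (nat, 'k) mpoly ring" and ?I = "quadric_ideal TYPE('k) N"
  let ?R = "quadric_ring TYPE('k) N" and ?M = "quadric_max_ideal TYPE('k) N"
  interpret P: cring ?P by (rule mpoly_ring_cring)
  interpret I: ideal ?I ?P by (rule quadric_ideal_ideal)
  interpret R: cring ?R
    unfolding quadric_ring_def by (rule I.quotient_is_cring) (rule P.is_cring)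
  interpret h: ring_hom_ring ?P ?R "quadric_coset N"
    unfolding quadric_ring_def by (rule I.rcos_ring_hom_ring)
  note carr = mpoly_ideal_closed(2)[OF irrelevant_power_ideal, where 'k='k]
  have "ideal ?M ?R"
    unfolding quadric_max_ideal_def
    by (rule R.genideal_ideal) (simp add: image_subset_iff var_in_carrier h.hom_closed)
  then have "ideal_prod ?R (carrier ?R) ?M = ?M"
    using R.ideal_prod_commute[OF R.oneideal] R.ideal_prod_one by simp
  then have M: "?M = quadric_coset N ` irrelevant_power N 1"
    using quadric_max_ideal_power[where 'k='k, of N 1] by (simp add: nat_pow_def ideals_set_def)
  have "quadric_coset N f [^]\<^bsub>?R\<^esub> q = quadric_coset N (f ^ q)" if "f \<in> irrelevant_power N 1" for f
    using h.hom_nat_pow[OF carr[OF that], of q] by (simp add: nat_pow_mpoly_ring)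
  then have "(\<lambda>a. a [^]\<^bsub>?R\<^esub> q) ` ?M = quadric_coset N ` (\<lambda>f. f ^ q) ` irrelevant_power N 1"
    unfolding M image_image by (rule image_cong[OF refl])
  then have F: "frobenius_power ?R ?M q =
      genideal (?P Quot ?I) (quadric_coset N ` (\<lambda>f. f ^ q) ` irrelevant_power N 1)"
    by (simp only: frobenius_power_def quadric_ring_def)
  have "(\<lambda>f. f ^ q) ` irrelevant_power N 1 \<subseteq> carrier ?P"
    using carr by (auto intro: mpoly_ring_closed)
  then have "quadric_coset N f \<in> frobenius_power ?R ?M q \<longleftrightarrow> f \<in> lifted_frobenius_power N q"
    if "f \<in> irrelevant_power N r" for f
    unfolding F lifted_frobenius_power_def
    by (intro P.coset_in_genideal_quotient_iff I.is_ideal carr[OF that])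
  then show ?thesis
    unfolding quadric_max_ideal_power by blast
qed

section \<open>The threshold exponent\<close>

lemma product_of_powers_in_irrelevant_power:
  "finite I \<Longrightarrow> I \<subseteq> {..N} \<Longrightarrow> (\<Prod>i\<in>I. var i ^ k) \<in> (irrelevant_power N (card I * k) :: (nat, 'k::field) mpoly set)"
proof (induction I rule: finite_induct)
  case empty
  then show ?case
    by (simp add: irrelevant_power_0 mpoly_ring_def)
next
  case (insert i I)
  have "var i ^ j \<in> (irrelevant_power N j :: (nat, 'k) mpoly set)" for j
  proof (induction j)
    case 0
    then show ?case by (simp add: irrelevant_power_0 mpoly_ring_def)
  next
    case (Suc j)
    then show ?case
      using irrelevant_power_mult[OF var_in_irrelevant_power Suc, of i] insert.prems by simp
  qed
  then show ?case
    using insert irrelevant_power_mult by fastforce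
qed

lemma threshold_exponent_quadric_ring:
  assumes char: "prime CHAR('k::field)" "CHAR('k) > 2" and N: "N \<ge> 3"
  shows "threshold_exponent (quadric_ring TYPE('k) N) (quadric_max_ideal TYPE('k) N)
    (quadric_max_ideal TYPE('k) N) (CHAR('k) ^ s) = (N - 1) * (CHAR('k) ^ s - 1)"
proof -
  define q where "q = CHAR('k) ^ s"
  have q: "q > 0"
    using char by (simp add: q_def)
  let ?L = "lifted_frobenius_power N q :: (nat, 'k) mpoly set"
  let ?Q = "\<Sum>i\<le>N. var i ^ 2 :: (nat, 'k) mpoly"
  let ?f = "\<Prod>i=2..N. var i ^ (q - 1) :: (nat, 'k) mpoly"
  have upper: "irrelevant_power N r \<subseteq> ?L" if r: "r > (N - 1) * (q - 1)" for r
  proof -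
    have "irrelevant_power N r \<subseteq> (irrelevant_power N ((N - 1) * (q - 1) + 1) :: (nat, 'k) mpoly set)"
      using r by (force simp: irrelevant_power_def)
    also have "\<dots> \<subseteq> ?L"
      by (intro irrelevant_power_subset_ideal lifted_frobenius_power_ideal
          quadric_in_lifted_frobenius_power power_in_lifted_frobenius_power char N q)
    finally show ?thesis .
  qed
  have lower: "\<not> irrelevant_power N ((N - 1) * (q - 1)) \<subseteq> ?L"
  proof
    assume "irrelevant_power N ((N - 1) * (q - 1)) \<subseteq> ?L"
    moreover have "?f \<in> irrelevant_power N (card {2..N} * (q - 1))"
      by (rule product_of_powers_in_irrelevant_power) auto
    ultimately have f: "?f \<in> ?L"
      using N by (auto simp: numeral_2_eq_2)
    note cl = mpoly_ideal_closed[OF bracket_ideal_ideal[of N q, where 'k='k]]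
    have Q: "?Q \<in> irrelevant_power N 1"
      by (rule sum_squares_in_irrelevant_power)
    have Qc: "?Q ^ (q - 1) \<in> carrier (mpoly_ring {..N})"
      by (intro mpoly_ring_closed mpoly_ideal_closed(2)[OF irrelevant_power_ideal Q])
    \<comment> \<open>The ideal quotient of \<open>(x_0^q, ..., x_N^q)\<close> by \<open>Q^(q-1)\<close>. It contains all generators of the lifted
        Frobenius power.\<close>
    define Z where "Z = {g \<in> carrier (mpoly_ring {..N}). ?Q ^ (q - 1) * g \<in> bracket_ideal N q}"
    have "?L \<subseteq> Z"
    proof (rule lifted_frobenius_power_minimal)
      show "ideal Z (mpoly_ring {..N})"
      proof (rule mpoly_ring_idealI)
        show "0 \<in> Z"
          using cl(1) by (simp add: Z_def mpoly_ring_def)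
        show "f + g \<in> Z" if "f \<in> Z" "g \<in> Z" for f g
          using that by (auto simp: Z_def distrib_left intro: mpoly_ring_closed cl(3))
        show "f * g \<in> Z" if "f \<in> carrier (mpoly_ring {..N})" "g \<in> Z" for f g
          using that by (auto simp: Z_def mult.left_commute[of _ f] intro: mpoly_ring_closed cl(5))
      qed (auto simp: Z_def)
      have "?Q ^ (q - 1) * ?Q = ?Q ^ q"
        using q by (simp add: power_eq_if mult.commute)
      then show "?Q \<in> Z"
        using power_in_bracket_ideal[OF char(1) Q, of s] mpoly_ideal_closed(2)[OF irrelevant_power_ideal Q]
        by (simp add: Z_def q_def)
      show "f ^ q \<in> Z" if "f \<in> irrelevant_power N 1" for f
        using power_in_bracket_ideal[OF char(1) that, of s] Qc
          mpoly_ring_closed(4)[OF mpoly_ideal_closed(2)[OF irrelevant_power_ideal that]]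
        by (auto simp: Z_def q_def intro: cl(5)[unfolded q_def])
    qed
    moreover have "odd CHAR('k)"
      using char by (simp add: prime_odd_nat)
    ultimately show False
      using f sum_squares_power_times_socle_notin_bracket_ideal[OF char(1), of N q s] N
      by (auto simp: Z_def q_def)
  qed
  show ?thesis
    unfolding threshold_exponent_def quadric_max_ideal_power_subset_frobenius_power_iff q_def[symmetric]
  proof (rule Max_eqI)
    have sub: "{r. \<not> irrelevant_power N r \<subseteq> ?L} \<subseteq> {..(N - 1) * (q - 1)}"
      using upper not_le by blast
    then show "finite {r. \<not> irrelevant_power N r \<subseteq> ?L}"
      using finite_subset by blast
    show "r \<le> (N - 1) * (q - 1)" if "r \<in> {r. \<not> irrelevant_power N r \<subseteq> ?L}" for r
      using that sub by blast
  qed (use lower in simp)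
qed

theorem corollary4p4:
  fixes n p :: nat
  assumes "perfect_field TYPE('k::field)"
    and "CHAR('k) = p"
    and "prime p" and "p > 2"
    and "n \<ge> 3" and "p > n - 2"
  shows "has_F_threshold (quadric_ring TYPE('k) (n + 1)) p
           (quadric_max_ideal TYPE('k) (n + 1)) (quadric_max_ideal TYPE('k) (n + 1)) (real n)"
proof -
  have "threshold_exponent (quadric_ring TYPE('k) (n + 1)) (quadric_max_ideal TYPE('k) (n + 1))
      (quadric_max_ideal TYPE('k) (n + 1)) (p ^ s) = n * (p ^ s - 1)" for s
    using threshold_exponent_quadric_ring[where 'k='k, of "n + 1" s] assms by simp
  moreover have "real (n * (p ^ s - 1)) / real (p ^ s) = real n - real n * (1 / real p) ^ s" for s
    using assms by (simp add: of_nat_diff field_simps)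
  moreover have "(\<lambda>s. real n - real n * (1 / real p) ^ s) \<longlonglongrightarrow> real n - real n * 0"
    using assms by (intro tendsto_intros LIMSEQ_realpow_zero) auto
  ultimately show ?thesis
    by (simp add: has_F_threshold_def)
qed

end
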